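(* The binary operation $\circledast$ on $I^{[2]}$ satisfies $$\mathbf{x}\circledast(\mathbf{y}\wedge\mathbf{z})=(\mathbf{x}\circledast\mathbf{y})\wedge(\mathbf{x}\circledast\mathbf{z})\quad\text{for all }\mathbf{x},\mathbf{y},\mathbf{z}\in I^{[2]}.$$
   Context: $I=[0,1]$ and $I^{[2]}=\{[a,b]:0\le a\le b\le 1\}$ is the set of closed subintervals of $I$ (single points $\{a\}=[a,a]$ included). On $I^{[2]}$, $[x_1,y_1]\wedge[x_2,y_2]=[x_1\wedge x_2,y_1\wedge y_2]$, where $\wedge$ on $I$ is minimum. The binary operation $\circledast$ on $I^{[2]}$ is defined by $\mathbf{x}\circledast\mathbf{y}=\max\{x\cdot y: x\in\mathbf{x},\,y\in\mathbf{y}\}$, where the real number on the right is identified with the corresponding one-point interval; i.e. $[x_1,x_2]\circledast[y_1,y_2]=\{x_2y_2\}=[x_2y_2,x_2y_2]$. *)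

theory Defs
  imports Complex_Main
begin

definition unit_intervals :: "real set set" where
  "unit_intervals = {{a..b} | a b. 0 \<le> a \<and> a \<le> b \<and> b \<le> 1}"

text \<open>The endpoints of a nonempty closed interval are its infimum and supremum;
  \<open>interval_meet_atLeastAtMost\<close> below gives the endpoint formula.\<close>

definition interval_meet :: "real set \<Rightarrow> real set \<Rightarrow> real set"  (infixr "\<sqinter>\<^sub>I" 70) where
  "x \<sqinter>\<^sub>I y = {min (Inf x) (Inf y)..min (Sup x) (Sup y)}"

text \<open>\<^const>\<open>Max\<close> is only meaningful on finite sets, so the maximum of the set of products is
  written with \<^const>\<open>Greatest\<close>; it is attained on closed intervals in the unit interval. The value
  is identified with the one-point interval at it.\<close>

definition interval_conv :: "real set \<Rightarrow> real set \<Rightarrow> real set"  (infixl "\<circledast>" 75) where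
  "x \<circledast> y = {GREATEST m. m \<in> {s * t | s t. s \<in> x \<and> t \<in> y}}"

lemma interval_meet_atLeastAtMost:
  assumes "a \<le> b" "c \<le> d"
  shows "{a..b} \<sqinter>\<^sub>I {c..d} = {min a c..min b d}"
  using assms by (simp add: interval_meet_def)

lemma interval_conv_atLeastAtMost:
  assumes "0 \<le> a" "a \<le> b" "0 \<le> c" "c \<le> d"
  shows "{a..b} \<circledast> {c..d} = {b * d..b * d}"
proof -
  have "(GREATEST m. m \<in> {s * t | s t. s \<in> {a..b} \<and> t \<in> {c..d}}) = b * d"
  proof (rule Greatest_equality)
    show "b * d \<in> {s * t | s t. s \<in> {a..b} \<and> t \<in> {c..d}}"
      using assms by auto
    show "m \<le> b * d" if "m \<in> {s * t | s t. s \<in> {a..b} \<and> t \<in> {c..d}}" for m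
      using that assms by (auto intro!: mult_mono)
  qed
  then show ?thesis
    by (simp add: interval_conv_def)
qed

lemma interval_meet_in_unit_intervals:
  assumes "x \<in> unit_intervals" "y \<in> unit_intervals"
  shows "x \<sqinter>\<^sub>I y \<in> unit_intervals"
proof -
  obtain a b c d where x: "x = {a..b}" "0 \<le> a" "a \<le> b" "b \<le> 1"
    and y: "y = {c..d}" "0 \<le> c" "c \<le> d" "d \<le> 1"
    using assms unfolding unit_intervals_def by blast
  have "x \<sqinter>\<^sub>I y = {min a c..min b d}" "0 \<le> min a c" "min a c \<le> min b d" "min b d \<le> 1"
    using x y by (auto simp: interval_meet_atLeastAtMost min_def)
  then show ?thesis
    unfolding unit_intervals_def by blast
qed

lemma interval_conv_in_unit_intervals:
  assumes "x \<in> unit_intervals" "y \<in> unit_intervals"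
  shows "x \<circledast> y \<in> unit_intervals"
proof -
  obtain a b c d where x: "x = {a..b}" "0 \<le> a" "a \<le> b" "b \<le> 1"
    and y: "y = {c..d}" "0 \<le> c" "c \<le> d" "d \<le> 1"
    using assms unfolding unit_intervals_def by blast
  have "x \<circledast> y = {b * d..b * d}" "0 \<le> b * d" "b * d \<le> 1"
    using x y by (auto simp: interval_conv_atLeastAtMost intro: mult_le_one)
  then show ?thesis
    unfolding unit_intervals_def by blast
qed

end

theory Submission
  imports Defs
begin

text \<open>On intervals with nonnegative endpoints, \<open>\<circledast>\<close> sees only the right endpoints and
  multiplies them, and \<open>\<sqinter>\<^sub>I\<close> acts on right endpoints as the minimum. Distributivity therefore
  reduces to \<open>b * min d f = min (b * d) (b * f)\<close> for the right endpoints \<open>b\<close>, \<open>d\<close>, \<open>f\<close>, which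
  holds because multiplication by \<open>b \<ge> 0\<close> is monotone.\<close>

theorem proposition10:
  shows "\<forall>x\<in>unit_intervals. \<forall>y\<in>unit_intervals. \<forall>z\<in>unit_intervals.
           x \<circledast> (y \<sqinter>\<^sub>I z) = (x \<circledast> y) \<sqinter>\<^sub>I (x \<circledast> z)"
proof (intro ballI)
  fix x y z
  assume "x \<in> unit_intervals" "y \<in> unit_intervals" "z \<in> unit_intervals"
  then obtain a b c d e f where
    x: "x = {a..b}" "0 \<le> a" "a \<le> b" and
    y: "y = {c..d}" "0 \<le> c" "c \<le> d" and
    z: "z = {e..f}" "0 \<le> e" "e \<le> f"
    unfolding unit_intervals_def by blast
  have "x \<circledast> (y \<sqinter>\<^sub>I z) = {a..b} \<circledast> {min c e..min d f}"
    using x y z by (simp add: interval_meet_atLeastAtMost)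
  also have "\<dots> = {b * min d f..b * min d f}"
    using x y z by (intro interval_conv_atLeastAtMost) auto
  also have "b * min d f = min (b * d) (b * f)"
    using x by (simp add: min_mult_distrib_left)
  also have "{min (b * d) (b * f)..min (b * d) (b * f)} = {b * d..b * d} \<sqinter>\<^sub>I {b * f..b * f}"
    by (simp only: interval_meet_atLeastAtMost order_refl)
  also have "\<dots> = (x \<circledast> y) \<sqinter>\<^sub>I (x \<circledast> z)"
    using x y z by (simp only: interval_conv_atLeastAtMost)
  finally show "x \<circledast> (y \<sqinter>\<^sub>I z) = (x \<circledast> y) \<sqinter>\<^sub>I (x \<circledast> z)" .
qed

end
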